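(* Let $(\mathfrak g,[\cdot,\cdot],\alpha,B)$ be a finite-dimensional irreducible quadratic multiplicative Hom-Lie algebra over $\mathbb K$ with $\dim\mathfrak g>1$. If $\mathcal Z(\mathfrak g)\neq\{0\}$, then $(\mathfrak g,[\cdot,\cdot],\alpha,B)$ is a double extension of a quadratic multiplicative Hom-Lie algebra $(V,[\cdot,\cdot]_V,\alpha_V,B_V)$ (by a one-dimensional Lie algebra) with $\dim V=\dim\mathfrak g-2$. If in addition $\alpha$ is an involution, then $(\mathfrak g,[\cdot,\cdot],\alpha,B)$ is an involutive double extension of a quadratic Hom-Lie algebra $(V,[\cdot,\cdot]_V,\alpha_V,B_V)$ with $\alpha_V$ an involution; and if $\alpha$ is invertible, then $(\mathfrak g,[\cdot,\cdot],\alpha,B)$ is a regular double extension of a quadratic Hom-Lie algebra $(V,[\cdot,\cdot]_V,\alpha_V,B_V)$ with $\alpha_V$ invertible.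
   Context: $\mathbb K$ is an algebraically closed field of characteristic $0$. A Hom-Lie algebra is a triple $(\mathfrak g,[\cdot,\cdot],\alpha)$ with $[\cdot,\cdot]$ a skew-symmetric bilinear bracket and $\alpha$ a linear map on the vector space $\mathfrak g$ such that $[\alpha(x),[y,z]]+[\alpha(y),[z,x]]+[\alpha(z),[x,y]]=0$ for all $x,y,z$; it is multiplicative if $\alpha([x,y])=[\alpha(x),\alpha(y)]$. It is quadratic with form $B$ if $B$ is a symmetric nondegenerate bilinear form with $B([x,y],z)=B(x,[y,z])$ and $B(\alpha(x),y)=B(x,\alpha(y))$ for all $x,y,z$. The center is $\mathcal Z(\mathfrak g)=\{x:[x,y]=0\ \forall y\in\mathfrak g\}$. An ideal is a subspace $I$ with $[I,\mathfrak g]\subseteq I$ and $\alpha(I)\subseteq I$; it is nondegenerate if $B|_{I\times I}$ is nondegenerate. A quadratic Hom-Lie algebra is irreducible if it has no nondegenerate ideal other than $\{0\}$ and $\mathfrak g$. Double extension (by the one-dimensional Lie algebra): given a quadratic multiplicative Hom-Lie algebra $(V,[\cdot,\cdot]_V,\alpha_V,B_V)$, a $B_V$-skew-symmetric linear map $\delta:V\to V$, $x_0\in V$, and $\lambda,\lambda_0\in\mathbb K$ such that, with $\rho_V(x)=[x,\cdot]_V$, one has $\alpha_V\delta\alpha_V-\lambda\delta=\rho_V(x_0)$, $\alpha_V\delta^2-\delta^2\alpha_V=\rho_V(\delta(x_0))$, and $(\lambda\delta+\rho_V(x_0))([x,y]_V)=[\delta(x),\alpha_V(y)]_V+[\alpha_V(x),\delta(y)]_V$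 for all $x,y\in V$, the double extension of $V$ by means of $(\delta,x_0,\lambda,\lambda_0)$ is $\mathbb K b\oplus V\oplus\mathbb K e$ with skew-symmetric bracket $[x,y]=[x,y]_V+B_V(\delta(x),y)e$, $[b,x]=\delta(x)$, $[e,\cdot]=0$; twist map $\alpha(x)=\alpha_V(x)+B_V(x_0,x)e$, $\alpha(b)=\lambda b+x_0+\lambda_0e$, $\alpha(e)=\lambda e$ ($x,y\in V$); and symmetric form $B$ equal to $B_V$ on $V$ with $B(b,e)=1$, $B(V,b)=B(V,e)=0$, $B(b,b)=B(e,e)=0$. It is called an involutive double extension when $\alpha_V$ is an involution ($\alpha_V^2=\mathrm{id}$), $\lambda\in\{-1,1\}$, $\alpha_V(x_0)=-\lambda x_0$ and $\lambda_0=-\frac1{2\lambda}B_V(x_0,x_0)$; it is called a regular double extension when $\alpha_V$ is invertible and $\lambda\ne0$. "Is a double extension" is understood up to isomorphism of quadratic Hom-Lie algebras (bijective linear map preserving brackets, twist maps and forms). *)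

theory Defs
  imports "HOL-Computational_Algebra.Polynomial" "HOL-Library.Product_Plus"
begin

text \<open>
  The carrier of an algebra is a subspace of an ambient vector space, given by a scalar
  multiplication on a type, so that algebras of different dimensions can live in one type
  and be quantified over. All axioms are relativised to the carrier; the values of
  the operations outside it are irrelevant.
\<close>

record ('k, 'v) qhl =
  carr :: "'v set"
  brk :: "'v \<Rightarrow> 'v \<Rightarrow> 'v"
  twist :: "'v \<Rightarrow> 'v"
  form :: "'v \<Rightarrow> 'v \<Rightarrow> 'k"

definition linear_on ::
  "('k \<Rightarrow> 'v::ab_group_add \<Rightarrow> 'v) \<Rightarrow> ('k \<Rightarrow> 'w::ab_group_add \<Rightarrow> 'w) \<Rightarrow> 'v set \<Rightarrow> ('v \<Rightarrow> 'w) \<Rightarrow> bool"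
  where "linear_on s t S f \<longleftrightarrow>
    (\<forall>x\<in>S. \<forall>y\<in>S. f (x + y) = f x + f y) \<and> (\<forall>c. \<forall>x\<in>S. f (s c x) = t c (f x))"

definition bilinear_on ::
  "('k \<Rightarrow> 'v::ab_group_add \<Rightarrow> 'v) \<Rightarrow> ('k \<Rightarrow> 'w::ab_group_add \<Rightarrow> 'w) \<Rightarrow> 'v set \<Rightarrow> ('v \<Rightarrow> 'v \<Rightarrow> 'w) \<Rightarrow> bool"
  where "bilinear_on s t S f \<longleftrightarrow>
    (\<forall>x\<in>S. linear_on s t S (\<lambda>y. f x y)) \<and> (\<forall>y\<in>S. linear_on s t S (\<lambda>x. f x y))"

definition nondegenerate_on :: "'v::zero set \<Rightarrow> ('v \<Rightarrow> 'v \<Rightarrow> 'k::zero) \<Rightarrow> bool"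
  where "nondegenerate_on S B \<longleftrightarrow> (\<forall>x\<in>S. (\<forall>y\<in>S. B x y = 0) \<longrightarrow> x = 0)"

definition finite_dim :: "('k::field \<Rightarrow> 'v::ab_group_add \<Rightarrow> 'v) \<Rightarrow> 'v set \<Rightarrow> bool"
  where "finite_dim s S \<longleftrightarrow> (\<exists>b. finite b \<and> module.span s b = S)"

definition hom_lie :: "('k::field \<Rightarrow> 'v::ab_group_add \<Rightarrow> 'v) \<Rightarrow> ('k, 'v) qhl \<Rightarrow> bool"
  where "hom_lie s A \<longleftrightarrow>
    vector_space s \<and> module.subspace s (carr A) \<and>
    (\<forall>x\<in>carr A. \<forall>y\<in>carr A. brk A x y \<in> carr A) \<and>
    (\<forall>x\<in>carr A. twist A x \<in> carr A) \<and>
    bilinear_on s s (carr A) (brk A) \<and>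
    linear_on s s (carr A) (twist A) \<and>
    (\<forall>x\<in>carr A. \<forall>y\<in>carr A. brk A x y = - brk A y x) \<and>
    (\<forall>x\<in>carr A. \<forall>y\<in>carr A. \<forall>z\<in>carr A.
      brk A (twist A x) (brk A y z) + brk A (twist A y) (brk A z x)
        + brk A (twist A z) (brk A x y) = 0)"

definition multiplicative :: "('k, 'v) qhl \<Rightarrow> bool"
  where "multiplicative A \<longleftrightarrow>
    (\<forall>x\<in>carr A. \<forall>y\<in>carr A. twist A (brk A x y) = brk A (twist A x) (twist A y))"

definition quadratic_hom_lie :: "('k::field \<Rightarrow> 'v::ab_group_add \<Rightarrow> 'v) \<Rightarrow> ('k, 'v) qhl \<Rightarrow> bool"
  where "quadratic_hom_lie s A \<longleftrightarrow>
    hom_lie s A \<and>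
    bilinear_on s (*) (carr A) (form A) \<and>
    (\<forall>x\<in>carr A. \<forall>y\<in>carr A. form A x y = form A y x) \<and>
    nondegenerate_on (carr A) (form A) \<and>
    (\<forall>x\<in>carr A. \<forall>y\<in>carr A. \<forall>z\<in>carr A. form A (brk A x y) z = form A x (brk A y z)) \<and>
    (\<forall>x\<in>carr A. \<forall>y\<in>carr A. form A (twist A x) y = form A x (twist A y))"

definition hl_center :: "('k, 'v::zero) qhl \<Rightarrow> 'v set"
  where "hl_center A = {x \<in> carr A. \<forall>y\<in>carr A. brk A x y = 0}"

definition hl_ideal :: "('k::field \<Rightarrow> 'v::ab_group_add \<Rightarrow> 'v) \<Rightarrow> ('k, 'v) qhl \<Rightarrow> 'v set \<Rightarrow> bool"
  where "hl_ideal s A I \<longleftrightarrow>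
    module.subspace s I \<and> I \<subseteq> carr A \<and>
    (\<forall>x\<in>I. \<forall>y\<in>carr A. brk A x y \<in> I) \<and> (\<forall>x\<in>I. twist A x \<in> I)"

definition hl_irreducible :: "('k::field \<Rightarrow> 'v::ab_group_add \<Rightarrow> 'v) \<Rightarrow> ('k, 'v) qhl \<Rightarrow> bool"
  where "hl_irreducible s A \<longleftrightarrow>
    (\<forall>I. hl_ideal s A I \<and> nondegenerate_on I (form A) \<longrightarrow> I = {0} \<or> I = carr A)"

definition involutive :: "('k, 'v) qhl \<Rightarrow> bool"
  where "involutive A \<longleftrightarrow> (\<forall>x\<in>carr A. twist A (twist A x) = x)"

definition regular :: "('k, 'v) qhl \<Rightarrow> bool"
  where "regular A \<longleftrightarrow> bij_betw (twist A) (carr A) (carr A)"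

definition qhl_iso ::
  "('k::field \<Rightarrow> 'v::ab_group_add \<Rightarrow> 'v) \<Rightarrow> ('k, 'v) qhl \<Rightarrow>
   ('k \<Rightarrow> 'w::ab_group_add \<Rightarrow> 'w) \<Rightarrow> ('k, 'w) qhl \<Rightarrow> ('v \<Rightarrow> 'w) \<Rightarrow> bool"
  where "qhl_iso s A t C f \<longleftrightarrow>
    bij_betw f (carr A) (carr C) \<and> linear_on s t (carr A) f \<and>
    (\<forall>x\<in>carr A. \<forall>y\<in>carr A. f (brk A x y) = brk C (f x) (f y)) \<and>
    (\<forall>x\<in>carr A. f (twist A x) = twist C (f x)) \<and>
    (\<forall>x\<in>carr A. \<forall>y\<in>carr A. form C (f x) (f y) = form A x y)"

definition dext_data ::
  "('k::field \<Rightarrow> 'v::ab_group_add \<Rightarrow> 'v) \<Rightarrow> ('k, 'v) qhl \<Rightarrow> ('v \<Rightarrow> 'v) \<Rightarrow> 'v \<Rightarrow> 'k \<Rightarrow> bool"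
  where "dext_data s V \<delta> x0 l \<longleftrightarrow>
    quadratic_hom_lie s V \<and> multiplicative V \<and>
    (\<forall>x\<in>carr V. \<delta> x \<in> carr V) \<and> linear_on s s (carr V) \<delta> \<and>
    (\<forall>x\<in>carr V. \<forall>y\<in>carr V. form V (\<delta> x) y = - form V x (\<delta> y)) \<and>
    x0 \<in> carr V \<and>
    (\<forall>x\<in>carr V. twist V (\<delta> (twist V x)) - s l (\<delta> x) = brk V x0 x) \<and>
    (\<forall>x\<in>carr V. twist V (\<delta> (\<delta> x)) - \<delta> (\<delta> (twist V x)) = brk V (\<delta> x0) x) \<and>
    (\<forall>x\<in>carr V. \<forall>y\<in>carr V.
      s l (\<delta> (brk V x y)) + brk V x0 (brk V x y)
        = brk V (\<delta> x) (twist V y) + brk V (twist V x) (\<delta> y))"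

text \<open>The triple \<open>(p, v, q)\<close> stands for the element \<open>p b + v + q e\<close> of the double extension.\<close>

fun dext_scale ::
  "('k::field \<Rightarrow> 'v \<Rightarrow> 'v) \<Rightarrow> 'k \<Rightarrow> 'k \<times> 'v \<times> 'k \<Rightarrow> 'k \<times> 'v \<times> 'k"
  where "dext_scale s c (p, v, q) = (c * p, s c v, c * q)"

text \<open>
  The operations below are the (bi)linear extensions of the defining values on \<open>b\<close>, \<open>V\<close>
  and \<open>e\<close>; the bracket uses \<open>[b, v] = - [v, b]\<close>, \<open>[b, b] = 0\<close> and that \<open>e\<close> is central.
\<close>

fun dext_brk ::
  "('k::field \<Rightarrow> 'v::ab_group_add \<Rightarrow> 'v) \<Rightarrow> ('k, 'v) qhl \<Rightarrow> ('v \<Rightarrow> 'v) \<Rightarrow>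
   'k \<times> 'v \<times> 'k \<Rightarrow> 'k \<times> 'v \<times> 'k \<Rightarrow> 'k \<times> 'v \<times> 'k"
  where "dext_brk s V \<delta> (p, v, q) (p', v', q') =
    (0, s p (\<delta> v') - s p' (\<delta> v) + brk V v v', form V (\<delta> v) v')"

fun dext_twist ::
  "('k::field \<Rightarrow> 'v::ab_group_add \<Rightarrow> 'v) \<Rightarrow> ('k, 'v) qhl \<Rightarrow> 'v \<Rightarrow> 'k \<Rightarrow> 'k \<Rightarrow>
   'k \<times> 'v \<times> 'k \<Rightarrow> 'k \<times> 'v \<times> 'k"
  where "dext_twist s V x0 l l0 (p, v, q) =
    (p * l, s p x0 + twist V v, p * l0 + form V x0 v + q * l)"

fun dext_form ::
  "('k::field, 'v) qhl \<Rightarrow> 'k \<times> 'v \<times> 'k \<Rightarrow> 'k \<times> 'v \<times> 'k \<Rightarrow> 'k"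
  where "dext_form V (p, v, q) (p', v', q') = p * q' + form V v v' + q * p'"

definition dext ::
  "('k::field \<Rightarrow> 'v::ab_group_add \<Rightarrow> 'v) \<Rightarrow> ('k, 'v) qhl \<Rightarrow> ('v \<Rightarrow> 'v) \<Rightarrow> 'v \<Rightarrow> 'k \<Rightarrow> 'k \<Rightarrow>
   ('k, 'k \<times> 'v \<times> 'k) qhl"
  where "dext s V \<delta> x0 l l0 =
    \<lparr>carr = UNIV \<times> carr V \<times> UNIV,
     brk = dext_brk s V \<delta>,
     twist = dext_twist s V x0 l l0,
     form = dext_form V\<rparr>"

definition is_dext_by ::
  "('k::field \<Rightarrow> 'v::ab_group_add \<Rightarrow> 'v) \<Rightarrow> ('k, 'v) qhl \<Rightarrow>
   ('k, 'v) qhl \<Rightarrow> ('v \<Rightarrow> 'v) \<Rightarrow> 'v \<Rightarrow> 'k \<Rightarrow> 'k \<Rightarrow> bool"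
  where "is_dext_by s A V \<delta> x0 l l0 \<longleftrightarrow>
    dext_data s V \<delta> x0 l \<and> (\<exists>f. qhl_iso s A (dext_scale s) (dext s V \<delta> x0 l l0) f)"

definition is_double_extension ::
  "('k::field \<Rightarrow> 'v::ab_group_add \<Rightarrow> 'v) \<Rightarrow> ('k, 'v) qhl \<Rightarrow> ('k, 'v) qhl \<Rightarrow> bool"
  where "is_double_extension s A V \<longleftrightarrow> (\<exists>\<delta> x0 l l0. is_dext_by s A V \<delta> x0 l l0)"

definition is_involutive_double_extension ::
  "('k::field \<Rightarrow> 'v::ab_group_add \<Rightarrow> 'v) \<Rightarrow> ('k, 'v) qhl \<Rightarrow> ('k, 'v) qhl \<Rightarrow> bool"
  where "is_involutive_double_extension s A V \<longleftrightarrow>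
    (\<exists>\<delta> x0 l l0. is_dext_by s A V \<delta> x0 l l0 \<and> involutive V \<and> l \<in> {-1, 1} \<and>
      twist V x0 = - s l x0 \<and> l0 = - (1 / (2 * l)) * form V x0 x0)"

definition is_regular_double_extension ::
  "('k::field \<Rightarrow> 'v::ab_group_add \<Rightarrow> 'v) \<Rightarrow> ('k, 'v) qhl \<Rightarrow> ('k, 'v) qhl \<Rightarrow> bool"
  where "is_regular_double_extension s A V \<longleftrightarrow>
    (\<exists>\<delta> x0 l l0. is_dext_by s A V \<delta> x0 l l0 \<and> regular V \<and> l \<noteq> 0)"

end

theory Submission
  imports Defs
begin

text \<open>
  Multiplicativity makes the center stable under the twist map, so it contains an eigenvector
  \<open>e\<close>. If \<open>B e e \<noteq> 0\<close>, the line through \<open>e\<close> would be a proper nondegenerate ideal; hence \<open>e\<close>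
  is isotropic and has a partner \<open>b\<close> with \<open>B b e = 1\<close> and \<open>B b b = 0\<close>. The space
  \<open>V = {e, b}\<^sup>\<bottom>\<close>, identified with the quotient of the ideal \<open>e\<^sup>\<bottom>\<close> by the line through \<open>e\<close>,
  inherits the structure, and \<open>\<delta> = [b, \<cdot>]\<close>, \<open>x0\<close> the \<open>V\<close>-part of \<open>\<alpha> b\<close> and \<open>l0 = B (\<alpha> b) b\<close> recover
  the algebra. The identities required of \<open>\<delta>\<close> are the components of the Hom-Jacobi identity and
  of multiplicativity; they are checked by pairing with elements of \<open>V\<close>.
\<close>

section \<open>Eigenvectors on invariant subspaces\<close>

text \<open>\<open>p(T) x\<close> in Horner form. \<open>T\<close> is applied to the argument, not
  to the result, so the rules for sums and multiples of polynomials hold for an arbitrary function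
  \<open>T\<close>; linearity on a subspace enters only when \<open>x\<close> is split.\<close>

definition poly_action ::
  "('k::comm_ring_1 \<Rightarrow> 'v::ab_group_add \<Rightarrow> 'v) \<Rightarrow> ('v \<Rightarrow> 'v) \<Rightarrow> 'k poly \<Rightarrow> 'v \<Rightarrow> 'v"
  where "poly_action s T p = fold_coeffs (\<lambda>a f x. s a x + f (T x)) p (\<lambda>x. 0)"

context vector_space
begin

lemma poly_action_0 [simp]: "poly_action scale T 0 x = 0"
  by (simp add: poly_action_def)

lemma poly_action_pCons [simp]:
  "poly_action scale T (pCons a p) x = scale a x + poly_action scale T p (T x)"
  by (cases "p = 0 \<and> a = 0") (auto simp: poly_action_def)

lemma poly_action_add:
  "poly_action scale T (p + q) x = poly_action scale T p x + poly_action scale T q x"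
  by (induction p q arbitrary: x rule: poly_induct2) (auto simp: scale_left_distrib)

lemma poly_action_smult:
  "poly_action scale T (smult c p) x = scale c (poly_action scale T p x)"
  by (induction p arbitrary: x) (auto simp: scale_right_distrib)

lemma poly_action_diff:
  "poly_action scale T (p - q) x = poly_action scale T p x - poly_action scale T q x"
  using poly_action_add[of T "p - q" q x] by simp

lemma poly_action_monom: "poly_action scale T (monom 1 n) x = (T ^^ n) x"
  by (induction n arbitrary: x) (simp_all add: monom_Suc monom_0 funpow_swap1)

context
  fixes W T
  assumes W: "subspace W"
    and T_closed: "\<And>x. x \<in> W \<Longrightarrow> T x \<in> W"
    and T_linear: "linear_on scale scale W T"
begin

lemma poly_action_linear:
  assumes "x \<in> W" "y \<in> W"
  shows "poly_action scale T p (x + scale c y)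
    = poly_action scale T p x + scale c (poly_action scale T p y)"
  using assms
proof (induction p arbitrary: x y)
  case (pCons a p)
  have "T (x + scale c y) = T x + scale c (T y)"
    using pCons.prems W T_linear by (simp add: linear_on_def subspace_scale)
  with pCons show ?case
    by (simp add: T_closed scale_right_distrib mult.commute)
qed simp

text \<open>The iterates of \<open>x\<close> under \<open>T\<close> stay in a finitely spanned
  space, so some iterate is a combination of the earlier ones; that relation is a monic
  polynomial.\<close>

lemma ex_annihilating_poly:
  assumes x: "x \<in> W" and F: "finite F" "W \<subseteq> span F"
  shows "\<exists>p. p \<noteq> 0 \<and> poly_action scale T p x = 0"
proof -
  define S where "S n = (\<lambda>i. (T ^^ i) x) ` {..<n}" for n :: nat
  have S_Suc: "S (Suc n) = insert ((T ^^ n) x) (S n)" for n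
    by (simp add: S_def lessThan_Suc)
  have "\<exists>k. (T ^^ k) x \<in> span (S k)"
  proof (rule ccontr)
    assume not: "\<nexists>k. (T ^^ k) x \<in> span (S k)"
    \<comment> \<open>If no iterate depended on its predecessors, the first
      \<open>card F + 1\<close> of them would be independent inside \<open>span F\<close>.\<close>
    have ind: "independent (S n) \<and> card (S n) = n" for n
    proof (induction n)
      case (Suc n)
      have "(T ^^ n) x \<notin> S n"
        using not span_base by blast
      moreover have "finite (S n)" by (simp add: S_def)
      ultimately show ?case
        using Suc not by (simp add: S_Suc independent_insert)
    qed (simp add: S_def independent_empty)
    have "(T ^^ i) x \<in> W" for i
      by (induction i) (simp_all add: x T_closed)
    then have "S (Suc (card F)) \<subseteq> span F"
      using F by (auto simp: S_def)
    with independent_span_bound[OF F(1)] ind[of "Suc (card F)"] show False by fastforce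
  qed
  then obtain k where k: "(T ^^ k) x \<in> span (S k)" by blast
  \<comment> \<open>a degree bound \<open>degree p < k\<close> would fail for \<open>k = 0\<close>\<close>
  define U where "U = {poly_action scale T p x |p. \<forall>i\<ge>k. coeff p i = 0}"
  have "subspace U"
    unfolding subspace_def
  proof (intro conjI ballI allI)
    show "0 \<in> U"
      unfolding U_def by (auto intro!: exI[of _ 0])
    show "y + z \<in> U" if yz: "y \<in> U" "z \<in> U" for y z
    proof -
      obtain p q where "y = poly_action scale T p x" "z = poly_action scale T q x"
        "\<forall>i\<ge>k. coeff p i = 0" "\<forall>i\<ge>k. coeff q i = 0"
        using yz unfolding U_def by blast
      then show ?thesis
        unfolding U_def by (auto simp: poly_action_add intro!: exI[of _ "p + q"])
    qed
    show "scale c y \<in> U" if y: "y \<in> U" for c y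
    proof -
      obtain p where "y = poly_action scale T p x" "\<forall>i\<ge>k. coeff p i = 0"
        using y unfolding U_def by blast
      then show ?thesis
        unfolding U_def by (auto simp: poly_action_smult intro!: exI[of _ "smult c p"])
    qed
  qed
  moreover have "S k \<subseteq> U"
  proof
    fix y assume "y \<in> S k"
    then obtain i where "i < k" "y = (T ^^ i) x" by (auto simp: S_def)
    then show "y \<in> U"
      unfolding U_def by (auto simp: poly_action_monom intro!: exI[of _ "monom 1 i"])
  qed
  ultimately have "(T ^^ k) x \<in> U"
    using k span_minimal by blast
  then obtain p where p: "(T ^^ k) x = poly_action scale T p x" "\<forall>i\<ge>k. coeff p i = 0"
    by (auto simp: U_def)
  \<comment> \<open>The leading coefficient 1 at \<open>k\<close> shows that the relation is a
    nonzero polynomial.\<close>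
  have "coeff (monom 1 k - p) k = 1"
    using p(2) by simp
  then have "monom 1 k - p \<noteq> 0" by (metis coeff_0 zero_neq_one)
  moreover have "poly_action scale T (monom 1 k - p) x = 0"
    by (simp add: poly_action_diff poly_action_monom p(1))
  ultimately show ?thesis by blast
qed

text \<open>Split off a root \<open>c\<close> of \<open>p\<close>. Either \<open>x\<close> is
  already an eigenvector for \<open>c\<close>, or \<open>T x - c x\<close> is a nonzero vector of
  \<open>W\<close> killed by the cofactor of smaller degree.\<close>

lemma ex_eigenvector_if_annihilated:
  assumes roots: "\<And>p :: 'a poly. degree p > 0 \<Longrightarrow> \<exists>z. poly p z = 0"
    and "x \<in> W" "x \<noteq> 0" "p \<noteq> 0" "poly_action scale T p x = 0"
  shows "\<exists>v\<in>W. \<exists>c. v \<noteq> 0 \<and> T v = scale c v"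
  using assms(2-)
proof (induction "degree p" arbitrary: p x)
  case 0
  then obtain a where "p = [:a:]" by (metis degree_eq_zeroE)
  with 0 show ?case by simp
next
  case (Suc n)
  then obtain c where "poly p c = 0" using roots[of p] by auto
  then obtain q where q: "p = [:- c, 1:] * q"
    by (metis poly_eq_0_iff_dvd dvdE)
  have q0: "q \<noteq> 0" using Suc q by auto
  define y where "y = T x + scale (- c) x"
  show ?case
  proof (cases "y = 0")
    case True
    then have "T x = scale c x" by (simp add: y_def)
    with Suc show ?thesis by blast
  next
    case False
    have "degree p = Suc (degree q)"
      using q0 by (simp add: q degree_mult_eq del: mult_pCons_left)
    moreover have "y \<in> W"
      using Suc W by (simp add: y_def T_closed subspace_add subspace_scale subspace_diff)
    \<comment> \<open>\<open>p\<close> acts on \<open>x\<close> as \<open>q\<close> at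
      \<open>T x\<close> minus \<open>c\<close> times \<open>q\<close> at \<open>x\<close>;
      linearity on \<open>W\<close> merges these into \<open>q\<close> at \<open>y\<close>.\<close>
    moreover have "poly_action scale T q y = poly_action scale T p x"
      using Suc by (simp only: y_def poly_action_linear T_closed q)
        (simp add: poly_action_add poly_action_smult poly_action_diff)
    ultimately show ?thesis
      using Suc.hyps(1)[of q y] Suc.hyps(2) Suc.prems q0 False by simp
  qed
qed

end

end

text \<open>A basis of \<open>U\<close> together with \<open>x\<close> is a basis of the larger
  span; \<open>F\<close> makes it finite, so that its cardinality really grows by one.\<close>

lemma (in vector_space) dim_insert_subspace:
  assumes "subspace U" "x \<notin> U" "finite F" "U \<subseteq> span F"
  shows "dim (insert x U) = Suc (dim U)"
proof -
  obtain C where C: "C \<subseteq> U" "independent C" "U \<subseteq> span C" "card C = dim U"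
    using basis_exists[of U] by blast
  have fin: "finite C"
    using independent_span_bound[OF assms(3) C(2)] C(1) assms(4) by blast
  have span: "span C = U"
    using C span_minimal assms(1) by blast
  then have "x \<notin> span C" "x \<notin> C" using assms C by auto
  then have "independent (insert x C)"
    using C by (simp add: independent_insert)
  moreover have "span (insert x C) = span (insert x U)"
    using span by (simp add: span_insert span_eq_iff[THEN iffD2, OF assms(1)])
  ultimately have "dim (insert x U) = card (insert x C)"
    by (intro dim_eq_card)
  with fin \<open>x \<notin> C\<close> C(4) show ?thesis by simp
qed

section \<open>Reduction by an isotropic central element\<close>

locale quadratic_hl = vector_space s
  for s :: "'k::field \<Rightarrow> 'v::ab_group_add \<Rightarrow> 'v" +
  fixes A :: "('k, 'v) qhl"
  assumes quadratic: "quadratic_hom_lie s A"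
begin

abbreviation G where "G \<equiv> carr A"
abbreviation br where "br \<equiv> brk A"
abbreviation tw where "tw \<equiv> twist A"
abbreviation B where "B \<equiv> form A"

lemma subspace_G:
  "subspace G"
  using quadratic unfolding quadratic_hom_lie_def hom_lie_def by (elim conjE)

lemma br_G [rule_format]:
  "\<forall>x\<in>G. \<forall>y\<in>G. br x y \<in> G"
  using quadratic unfolding quadratic_hom_lie_def hom_lie_def by (elim conjE)

lemma tw_G [rule_format]:
  "\<forall>x\<in>G. tw x \<in> G"
  using quadratic unfolding quadratic_hom_lie_def hom_lie_def by (elim conjE)

lemma br_bilinear:
  "bilinear_on s s G br"
  using quadratic unfolding quadratic_hom_lie_def hom_lie_def by (elim conjE)

lemma form_bilinear:
  "bilinear_on s (*) G B"
  using quadratic unfolding quadratic_hom_lie_def hom_lie_def by (elim conjE)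

lemma tw_linear:
  "linear_on s s G tw"
  using quadratic unfolding quadratic_hom_lie_def hom_lie_def by (elim conjE)

lemma closed [simp]:
  "0 \<in> G"
  "\<lbrakk>x \<in> G; y \<in> G\<rbrakk> \<Longrightarrow> x + y \<in> G"
  "\<lbrakk>x \<in> G; y \<in> G\<rbrakk> \<Longrightarrow> x - y \<in> G"
  "x \<in> G \<Longrightarrow> - x \<in> G"
  "x \<in> G \<Longrightarrow> s c x \<in> G"
  "\<lbrakk>x \<in> G; y \<in> G\<rbrakk> \<Longrightarrow> br x y \<in> G"
  "x \<in> G \<Longrightarrow> tw x \<in> G"
  using subspace_G br_G tw_G
  by (simp_all add: subspace_0 subspace_add subspace_diff subspace_neg subspace_scale)

lemma scale_simps [simp]:
  assumes "x \<in> G"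
  shows "tw (s c x) = s c (tw x)"
    and "z \<in> G \<Longrightarrow> br (s c x) z = s c (br x z)"
    and "z \<in> G \<Longrightarrow> br z (s c x) = s c (br z x)"
    and "z \<in> G \<Longrightarrow> B (s c x) z = c * B x z"
    and "z \<in> G \<Longrightarrow> B z (s c x) = c * B z x"
  using br_bilinear form_bilinear tw_linear assms
  by (simp_all add: bilinear_on_def linear_on_def)

lemma minus_simps [simp]:
  assumes "x \<in> G"
  shows "tw (- x) = - tw x"
    and "z \<in> G \<Longrightarrow> br (- x) z = - br x z"
    and "z \<in> G \<Longrightarrow> br z (- x) = - br z x"
    and "z \<in> G \<Longrightarrow> B (- x) z = - B x z"
    and "z \<in> G \<Longrightarrow> B z (- x) = - B z x"
  using scale_simps[OF assms, where c = "- 1"] by simp_all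

lemma linear_simps [simp]:
  assumes "x \<in> G" "y \<in> G"
  shows "tw (x + y) = tw x + tw y" "tw (x - y) = tw x - tw y"
    and "z \<in> G \<Longrightarrow> br (x + y) z = br x z + br y z" "z \<in> G \<Longrightarrow> br (x - y) z = br x z - br y z"
    and "z \<in> G \<Longrightarrow> br z (x + y) = br z x + br z y" "z \<in> G \<Longrightarrow> br z (x - y) = br z x - br z y"
    and "z \<in> G \<Longrightarrow> B (x + y) z = B x z + B y z" "z \<in> G \<Longrightarrow> B (x - y) z = B x z - B y z"
    and "z \<in> G \<Longrightarrow> B z (x + y) = B z x + B z y" "z \<in> G \<Longrightarrow> B z (x - y) = B z x - B z y"
proof -
  \<comment> \<open>Kept general in \<open>y\<close>: the difference rules are the instances at
    \<open>- y\<close>.\<close>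
  have *: "tw (x + y) = tw x + tw y"
    "z \<in> G \<Longrightarrow> br (x + y) z = br x z + br y z" "z \<in> G \<Longrightarrow> br z (x + y) = br z x + br z y"
    "z \<in> G \<Longrightarrow> B (x + y) z = B x z + B y z" "z \<in> G \<Longrightarrow> B z (x + y) = B z x + B z y"
    if "y \<in> G" for y z
    using br_bilinear form_bilinear tw_linear assms(1) that
    by (simp_all add: bilinear_on_def linear_on_def)
  show "tw (x + y) = tw x + tw y" "tw (x - y) = tw x - tw y"
    and "z \<in> G \<Longrightarrow> br (x + y) z = br x z + br y z" "z \<in> G \<Longrightarrow> br (x - y) z = br x z - br y z"
    and "z \<in> G \<Longrightarrow> br z (x + y) = br z x + br z y" "z \<in> G \<Longrightarrow> br z (x - y) = br z x - br z y"
    and "z \<in> G \<Longrightarrow> B (x + y) z = B x z + B y z" "z \<in> G \<Longrightarrow> B (x - y) z = B x z - B y z"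
    and "z \<in> G \<Longrightarrow> B z (x + y) = B z x + B z y" "z \<in> G \<Longrightarrow> B z (x - y) = B z x - B z y"
    using *[of y] *[of "- y"] assms by simp_all
qed

lemma zero_simps [simp]:
  shows "tw 0 = 0"
    and "x \<in> G \<Longrightarrow> br 0 x = 0" "x \<in> G \<Longrightarrow> br x 0 = 0"
    and "x \<in> G \<Longrightarrow> B 0 x = 0" "x \<in> G \<Longrightarrow> B x 0 = 0"
  using scale_simps[of 0, where c = 0] scale_simps[where x = x and c = 0] by simp_all

lemma skew [rule_format]:
  "\<forall>x\<in>G. \<forall>y\<in>G. br x y = - br y x"
  using quadratic unfolding quadratic_hom_lie_def hom_lie_def by (elim conjE)

lemma jacobi [rule_format]:
  "\<forall>x\<in>G. \<forall>y\<in>G. \<forall>z\<in>G.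
    br (tw x) (br y z) + br (tw y) (br z x) + br (tw z) (br x y) = 0"
  using quadratic unfolding quadratic_hom_lie_def hom_lie_def by (elim conjE)

lemma form_sym [rule_format]:
  "\<forall>x\<in>G. \<forall>y\<in>G. B x y = B y x"
  using quadratic unfolding quadratic_hom_lie_def hom_lie_def by (elim conjE)

lemma nondegenerate:
  "nondegenerate_on G B"
  using quadratic unfolding quadratic_hom_lie_def hom_lie_def by (elim conjE)

lemma invariant [rule_format]:
  "\<forall>x\<in>G. \<forall>y\<in>G. \<forall>z\<in>G. B (br x y) z = B x (br y z)"
  using quadratic unfolding quadratic_hom_lie_def hom_lie_def by (elim conjE)

lemma twist_adjoint [rule_format]:
  "\<forall>x\<in>G. \<forall>y\<in>G. B (tw x) y = B x (tw y)"
  using quadratic unfolding quadratic_hom_lie_def hom_lie_def by (elim conjE)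

lemma eq_0_if_orthogonal: "\<lbrakk>x \<in> G; \<And>y. y \<in> G \<Longrightarrow> B x y = 0\<rbrakk> \<Longrightarrow> x = 0"
  using nondegenerate unfolding nondegenerate_on_def by blast

lemma subspace_center: "subspace (hl_center A)"
  unfolding subspace_def hl_center_def by auto

text \<open>Multiplicativity alone yields only \<open>br (tw x) (tw y) = 0\<close>. Pairing with
  \<open>z\<close> and moving the twist across the form turns \<open>br y z\<close> into
  \<open>br (tw y) (tw z)\<close>, which allows an arbitrary \<open>y\<close>.\<close>

lemma center_twist_closed:
  assumes "multiplicative A" "x \<in> hl_center A"
  shows "tw x \<in> hl_center A"
proof -
  have x: "x \<in> G" "\<And>y. y \<in> G \<Longrightarrow> br x y = 0"
    using assms(2) by (auto simp: hl_center_def)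
  have "br (tw x) y = 0" if "y \<in> G" for y
  proof (rule eq_0_if_orthogonal)
    fix z assume "z \<in> G"
    then have "B (br (tw x) y) z = B x (br (tw y) (tw z))"
      using x that assms(1)
      by (simp add: invariant twist_adjoint multiplicative_def)
    also have "\<dots> = B (br x (tw y)) (tw z)"
      using x(1) that \<open>z \<in> G\<close> by (simp add: invariant)
    also have "\<dots> = 0" using x that \<open>z \<in> G\<close> by simp
    finally show "B (br (tw x) y) z = 0" .
  qed (use x that in simp)
  with x show ?thesis by (simp add: hl_center_def)
qed

end

section \<open>The hyperbolic pair \<open>e\<close>, \<open>b\<close> and its orthogonal
  complement\<close>

locale central_reduction = quadratic_hl s A
  for s :: "'k::field_char_0 \<Rightarrow> 'v::ab_group_add \<Rightarrow> 'v" and A :: "('k, 'v) qhl" +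
  fixes e b :: 'v and l :: 'k
  assumes mult: "multiplicative A"
    and e_center: "e \<in> hl_center A" and tw_e [simp]: "tw e = s l e"
    and b_G [simp]: "b \<in> G"
    and Bee [simp]: "B e e = 0" and Bbe [simp]: "B b e = 1" and Bbb [simp]: "B b b = 0"
begin

lemma e_G [simp]: "e \<in> G"
  using e_center by (simp add: hl_center_def)

lemma Beb [simp]: "B e b = 1"
  using form_sym[of e b] by simp

lemma br_e [simp]: "x \<in> G \<Longrightarrow> br e x = 0" "x \<in> G \<Longrightarrow> br x e = 0"
  using e_center skew[of x e] by (auto simp: hl_center_def)

lemma br_b_b [simp]: "br b b = 0"
proof -
  have "br b b + br b b = 0"
    using skew[of b b] by (metis add.right_inverse b_G)
  then have "s 2 (br b b) = 0"
    using scale_left_distrib[of 1 1 "br b b"] by simp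
  then show ?thesis by simp
qed

lemma B_br_e [simp]: "\<lbrakk>x \<in> G; y \<in> G\<rbrakk> \<Longrightarrow> B (br x y) e = 0"
  by (simp add: invariant)

lemma B_br_b [simp]: "x \<in> G \<Longrightarrow> B (br b x) b = 0"
  by (simp add: skew[of b x] invariant)

lemma B_tw_e [simp]: "x \<in> G \<Longrightarrow> B (tw x) e = l * B x e"
  by (simp add: twist_adjoint)

lemma tw_br: "\<lbrakk>x \<in> G; y \<in> G\<rbrakk> \<Longrightarrow> tw (br x y) = br (tw x) (tw y)"
  using mult by (simp add: multiplicative_def)

definition H where "H = {x \<in> G. B x e = 0 \<and> B x b = 0}"

text \<open>Orthogonal projection onto \<open>H\<close> along the hyperbolic plane of
  \<open>b\<close> and \<open>e\<close>. The two vectors are dual to each other, so the coefficient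
  of \<open>b\<close> is the pairing with \<open>e\<close> and vice versa.\<close>

definition P where "P x = x - s (B x e) b - s (B x b) e"

lemma P_H [simp]: "x \<in> G \<Longrightarrow> P x \<in> H"
  by (simp add: H_def P_def)

text \<open>By \<open>B_br_e\<close> and \<open>B_br_b\<close> the map \<open>br b\<close> lands in
  \<open>H\<close> without projection, so it can serve as \<delta> directly.\<close>

lemma H_closed [simp]:
  "0 \<in> H" "\<lbrakk>x \<in> H; y \<in> H\<rbrakk> \<Longrightarrow> x + y \<in> H" "\<lbrakk>x \<in> H; y \<in> H\<rbrakk> \<Longrightarrow> x - y \<in> H"
  "x \<in> H \<Longrightarrow> s c x \<in> H" "x \<in> G \<Longrightarrow> br b x \<in> H"
  by (simp_all add: H_def)

lemma H_D [simp]: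
  "x \<in> H \<Longrightarrow> x \<in> G" "x \<in> H \<Longrightarrow> B x e = 0" "x \<in> H \<Longrightarrow> B x b = 0"
  by (simp_all add: H_def)

lemma H_D' [simp]: "x \<in> H \<Longrightarrow> B e x = 0" "x \<in> H \<Longrightarrow> B b x = 0"
  by (simp_all add: form_sym[of _ x])

lemma P_id [simp]: "x \<in> H \<Longrightarrow> P x = x"
  by (simp add: P_def)

lemma P_b [simp]: "P b = 0" and P_e [simp]: "P e = 0"
  by (simp_all add: P_def)

lemma P_add [simp]: "\<lbrakk>x \<in> G; y \<in> G\<rbrakk> \<Longrightarrow> P (x + y) = P x + P y"
  by (simp add: P_def scale_left_distrib)

lemma P_scale [simp]: "x \<in> G \<Longrightarrow> P (s c x) = s c (P x)"
  by (simp add: P_def scale_right_diff_distrib)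

lemma P_minus [simp]: "x \<in> G \<Longrightarrow> P (- x) = - P x"
  using P_scale[of x "- 1"] by simp

lemma P_diff [simp]: "\<lbrakk>x \<in> G; y \<in> G\<rbrakk> \<Longrightarrow> P (x - y) = P x - P y"
  using P_add[of x "- y"] by simp

lemma P_zero [simp]: "P 0 = 0"
  using P_scale[of e 0] by simp

lemma subspace_H: "subspace H"
  by (simp add: subspace_def)

lemma B_P [simp]:
  assumes "x \<in> G" "z \<in> H"
  shows "B (P x) z = B x z" "B z (P x) = B z x"
  using assms by (simp_all add: P_def)

text \<open>On vectors orthogonal to \<open>e\<close>, \<open>P\<close> only subtracts a multiple of
  the central element \<open>e\<close>. With \<open>P_tw_P\<close> this makes \<open>P\<close> act
  as the quotient map by the line of \<open>e\<close>, compatible with bracket and twist.\<close>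

lemma br_P [simp]:
  assumes "x \<in> G" "B x e = 0" "y \<in> G"
  shows "br (P x) y = br x y" "br y (P x) = br y x"
  using assms by (simp_all add: P_def)

lemma P_tw_P [simp]: "\<lbrakk>x \<in> G; B x e = 0\<rbrakk> \<Longrightarrow> P (tw (P x)) = P (tw x)"
  by (simp add: P_def[of x])

lemma decompose: "x = s (B x e) b + P x + s (B x b) e"
  by (simp add: P_def)

lemma H_eqI:
  assumes "x \<in> H" "y \<in> H" "\<And>z. z \<in> H \<Longrightarrow> B x z = B y z"
  shows "x = y"
proof -
  have "B (x - y) z = 0" if "z \<in> G" for z
  proof -
    have "B (x - y) z = B (x - y) (P z)"
      using assms(1,2) that by simp
    \<comment> \<open>\<open>B_P\<close> as a rewrite rule would undo the passage from
      \<open>z\<close> to \<open>P z\<close>.\<close>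
    also have "\<dots> = 0"
      using assms that by (simp del: B_P)
    finally show ?thesis .
  qed
  then show ?thesis
    using assms(1,2) eq_0_if_orthogonal[of "x - y"] by simp
qed

section \<open>The reduced algebra and its extension data\<close>

definition V :: "('k, 'v) qhl" where
  "V = \<lparr>carr = H, brk = (\<lambda>x y. P (br x y)), twist = (\<lambda>x. P (tw x)), form = B\<rparr>"

lemma V_simps [simp]:
  "carr V = H" "brk V x y = P (br x y)" "twist V x = P (tw x)" "form V = B"
  by (simp_all add: V_def)

definition x0 where "x0 = P (tw b)"
definition l0 where "l0 = B (tw b) b"

lemma x0_H [simp]: "x0 \<in> H"
  by (simp add: x0_def)

lemma tw_b: "tw b = s l b + x0 + s l0 e"
proof -
  have "tw b = s (B (tw b) e) b + P (tw b) + s (B (tw b) b) e"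
    by (rule decompose)
  also have "\<dots> = s l b + x0 + s l0 e" by (simp add: x0_def l0_def)
  finally show ?thesis .
qed

lemma hom_lie_V: "hom_lie s V"
  unfolding hom_lie_def bilinear_on_def linear_on_def
proof (intro conjI ballI allI)
  fix x y z assume xyz: "x \<in> carr V" "y \<in> carr V" "z \<in> carr V"
  \<comment> \<open>All twisted elements and inner brackets are orthogonal to \<open>e\<close>, so
    \<open>br_P\<close> removes the inner projections and one outer \<open>P\<close>
    remains.\<close>
  then have "brk V (twist V x) (brk V y z) + brk V (twist V y) (brk V z x)
      + brk V (twist V z) (brk V x y)
    = P (br (tw x) (br y z) + br (tw y) (br z x) + br (tw z) (br x y))"
    by simp
  then show "brk V (twist V x) (brk V y z) + brk V (twist V y) (brk V z x)
      + brk V (twist V z) (brk V x y) = 0"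
    using xyz jacobi[of x y z] by simp
next
  fix x y assume "x \<in> carr V" "y \<in> carr V"
  then show "brk V x y = - brk V y x"
    by (simp add: skew[of x y])
qed (simp_all add: vector_space_axioms subspace_H)

lemma quadratic_V: "quadratic_hom_lie s V"
  unfolding quadratic_hom_lie_def
proof (intro conjI)
  show "nondegenerate_on (carr V) (form V)"
    using H_eqI[of _ 0] by (auto simp: nondegenerate_on_def)
  show "\<forall>x\<in>carr V. \<forall>y\<in>carr V. form V x y = form V y x"
    by (simp add: form_sym)
qed (simp_all add: hom_lie_V bilinear_on_def linear_on_def invariant twist_adjoint)

lemma multiplicative_V: "multiplicative V"
  by (simp add: multiplicative_def tw_br)

lemma dext_data_V: "dext_data s V (br b) x0 l"
  unfolding dext_data_def
proof (intro conjI ballI)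
  fix x y assume "x \<in> carr V" "y \<in> carr V"
  then have [simp]: "x \<in> H" "y \<in> H" by simp_all
  show "form V (br b x) y = - form V x (br b y)"
    by (simp add: skew[of b x] invariant)
  \<comment> \<open>the \<open>V\<close>-component of the Hom-Jacobi identity on \<open>b, x, y\<close>\<close>
  have "br (tw b) (br x y) + br (tw x) (br y b) + br (tw y) (br b x) = 0"
    by (simp add: jacobi)
  moreover have "br (tw x) (br y b) = - br (tw x) (br b y)"
    by (simp add: skew[of y b])
  moreover have "br (tw y) (br b x) = - br (br b x) (tw y)"
    by (simp add: skew[of "tw y"])
  ultimately have "br (tw b) (br x y) = br (br b x) (tw y) + br (tw x) (br b y)"
    by (simp add: algebra_simps)
  then have "P (s l (br b (br x y)) + br x0 (br x y)) = P (br (br b x) (tw y) + br (tw x) (br b y))"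
    by (simp add: tw_b)
  then show "s l (br b (brk V x y)) + brk V x0 (brk V x y)
    = brk V (br b x) (twist V y) + brk V (twist V x) (br b y)"
    by simp
next
  fix x assume "x \<in> carr V"
  then have [simp]: "x \<in> H" by simp
  show "twist V (br b (twist V x)) - s l (br b x) = brk V x0 x"
  proof (rule H_eqI)
    fix z assume [simp]: "z \<in> H"
    \<comment> \<open>the \<open>e\<close>-component of multiplicativity on \<open>x, z\<close>\<close>
    have "B (br b (tw x)) (tw z) = B b (tw (br x z))"
      by (simp add: tw_br invariant)
    also have "\<dots> = B (tw b) (br x z)"
      by (simp add: twist_adjoint)
    \<comment> \<open>The \<open>e\<close>-term of \<open>tw b\<close> disappears because brackets
      are orthogonal to \<open>e\<close>.\<close>
    also have "\<dots> = l * B (br b x) z + B (br x0 x) z"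
      by (simp add: tw_b invariant form_sym[of e])
    finally show "B (twist V (br b (twist V x)) - s l (br b x)) z = B (brk V x0 x) z"
      by (simp add: twist_adjoint)
  qed simp_all
  show "twist V (br b (br b x)) - br b (br b (twist V x)) = brk V (br b x0) x"
  proof (rule H_eqI)
    fix z assume [simp]: "z \<in> H"
    \<comment> \<open>the \<open>e\<close>-component of the Hom-Jacobi identity on \<open>b, x, z\<close>\<close>
    have "B (br (tw b) (br x z) + br (tw x) (br z b) + br (tw z) (br b x)) b = 0"
      by (simp add: jacobi)
    moreover have "B (br (tw b) (br x z)) b = B (br (br b x0) x) z"
      by (simp add: tw_b invariant form_sym[of _ b])
    moreover have "B (br (tw x) (br z b)) b = B (br b (br b (tw x))) z"
    proof -
      \<comment> \<open>\<open>br b\<close> is skew for the form, so its square is self-adjoint; the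
        two sign changes cancel.\<close>
      have "br (br z b) b = br b (br b z)"
        by (simp add: skew[of z b] skew[of "br b z" b])
      moreover have "br b (br b (tw x)) = br (br (tw x) b) b"
        by (simp add: skew[of b "tw x"] skew[of b "br (tw x) b"])
      ultimately show ?thesis by (simp add: invariant)
    qed
    moreover have "B (br (tw z) (br b x)) b = - B (tw (br b (br b x))) z"
      by (simp add: invariant skew[of "br b x" b] twist_adjoint form_sym[of _ "tw z"])
    ultimately show "B (twist V (br b (br b x)) - br b (br b (twist V x))) z
      = B (brk V (br b x0) x) z"
      by (simp add: algebra_simps)
  qed simp_all
qed (simp_all add: quadratic_V multiplicative_V linear_on_def)

section \<open>Isomorphism with the double extension\<close>

lemma qhl_iso_dext: "qhl_iso s A (dext_scale s) (dext s V (br b) x0 l l0) (\<lambda>x. (B x e, P x, B x b))"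
  (is "qhl_iso s A ?t ?D ?f")
proof -
  have D [simp]: "carr ?D = UNIV \<times> H \<times> UNIV" "brk ?D = dext_brk s V (br b)"
    "twist ?D = dext_twist s V x0 l l0" "form ?D = dext_form V"
    by (simp_all add: dext_def)
  have f: "?f (s p b + v + s q e) = (p, v, q)" if "v \<in> H" for p v q
    using that by simp
  have ex: "\<exists>p v q. v \<in> H \<and> x = s p b + v + s q e" if "x \<in> G" for x
    using decompose[of x] that P_H by blast
  have bij: "bij_betw ?f (carr A) (carr ?D)"
    by (rule bij_betw_byWitness[where f' = "\<lambda>(p, v, q). s p b + v + s q e"])
      (auto simp flip: decompose)
  have lin: "linear_on s ?t G ?f"
    by (simp add: linear_on_def)
  have brk_form: "?f (br x y) = brk ?D (?f x) (?f y) \<and> form ?D (?f x) (?f y) = B x y"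
    if xy: "x \<in> G" "y \<in> G" for x y
  proof -
    obtain p v q where x: "v \<in> H" "x = s p b + v + s q e" using ex xy by blast
    obtain p' v' q' where y: "v' \<in> H" "y = s p' b + v' + s q' e" using ex xy by blast
    have vb: "br v b = - br b v" "br v' b = - br b v'"
      using x(1) y(1) by (simp_all add: skew[of _ b])
    \<comment> \<open>The \<open>e\<close>-coefficient of \<open>br v v'\<close> is its pairing with
      \<open>b\<close>; invariance turns this into the cocycle term of
      \<open>dext_brk\<close>.\<close>
    have "B (br b v) v' = - B (br v b) v'"
      using x(1) y(1) vb(1) by simp
    also have "\<dots> = - B v (br b v')"
      using x(1) y(1) by (simp add: invariant)
    also have "\<dots> = B v (br v' b)"
      using x(1) y(1) vb(2) by simp
    also have "\<dots> = B (br v v') b"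
      using x(1) y(1) by (simp add: invariant)
    finally have B_vv': "B (br v v') b = B (br b v) v'" ..
    then show ?thesis
      unfolding x(2) y(2) f[OF x(1)] f[OF y(1)]
      using x(1) y(1) by (simp add: vb(1) B_vv' algebra_simps)
  qed
  have "?f (tw x) = twist ?D (?f x)" if "x \<in> G" for x
  proof -
    obtain p v q where x: "v \<in> H" "x = s p b + v + s q e" using ex \<open>x \<in> G\<close> by blast
    \<comment> \<open>The \<open>e\<close>-coefficient of \<open>tw v\<close>: by self-adjointness
      it pairs \<open>v\<close> with \<open>tw b\<close>, of which only \<open>x0\<close> is not
      orthogonal to \<open>v\<close> by construction.\<close>
    have "B (tw v) b = B x0 v"
      using x(1) by (simp add: twist_adjoint tw_b form_sym[of v])
    then show ?thesis
      unfolding x(2) f[OF x(1)] using x(1)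
      by (simp add: x0_def[symmetric] l0_def[symmetric] algebra_simps)
  qed
  with bij lin brk_form show ?thesis
    unfolding qhl_iso_def by blast
qed

lemma is_dext_by_V: "is_dext_by s A V (br b) x0 l l0"
  unfolding is_dext_by_def using dext_data_V qhl_iso_dext by blast

section \<open>Dimension, involutivity and regularity\<close>

lemma dim_G:
  assumes "finite_dim s G"
  shows "dim G = dim H + 2"
proof -
  obtain F where F: "finite F" "span F = G"
    using assms by (auto simp: finite_dim_def)
  define U where "U = span (insert b H)"
  have "U \<subseteq> G"
    unfolding U_def by (rule span_minimal) (auto simp: subspace_G)
  \<comment> \<open>Since \<open>b\<close> is isotropic and orthogonal to \<open>H\<close>, all of
    \<open>U\<close> is orthogonal to \<open>b\<close>, whereas \<open>B b e = 1\<close>; hence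
    \<open>e\<close> adds a further dimension.\<close>
  have "B b x = 0" if "x \<in> U" for x
  proof -
    have "U \<subseteq> {x \<in> G. B b x = 0}"
      unfolding U_def by (rule span_minimal) (auto simp: subspace_def)
    with that show ?thesis by blast
  qed
  then have "e \<notin> U" by force
  have "b \<notin> H" using Bbe H_D(2)[of b] by force
  have "span (insert e U) = G"
  proof
    show "span (insert e U) \<subseteq> G"
      using \<open>U \<subseteq> G\<close> by (intro span_minimal) (auto simp: subspace_G)
    show "G \<subseteq> span (insert e U)"
    proof
      fix x assume "x \<in> G"
      then have "s (B x e) b + P x \<in> U"
        unfolding U_def by (intro span_add span_scale) (auto intro: span_base)
      then have "s (B x e) b + P x + s (B x b) e \<in> span (insert e U)"
        by (intro span_add[OF span_base] span_scale[OF span_base]) auto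
      then show "x \<in> span (insert e U)" by (simp flip: decompose)
    qed
  qed
  then have "dim G = dim (insert e U)" by (metis dim_span)
  also have "\<dots> = Suc (dim U)"
    using F(2) \<open>U \<subseteq> G\<close>
    by (intro dim_insert_subspace[OF _ \<open>e \<notin> U\<close> F(1)]) (simp_all add: U_def)
  also have "dim U = dim (insert b H)" by (simp add: U_def)
  also have "\<dots> = Suc (dim H)"
    using dim_insert_subspace[OF subspace_H \<open>b \<notin> H\<close> F(1)] H_D(1) F(2) by blast
  finally show ?thesis by simp
qed

text \<open>Compare components in \<alpha>\<alpha> = id: at \<open>e\<close> it gives
  \<open>l * l = 1\<close>, at \<open>b\<close> the \<open>V\<close>-component gives the twist of
  \<open>x0\<close> and the \<open>e\<close>-component gives \<open>l0\<close>.\<close>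

lemma involutive_V:
  assumes "involutive A"
  shows "involutive V" "l \<in> {-1, 1}" "twist V x0 = - s l x0" "l0 = - (1 / (2 * l)) * B x0 x0"
proof -
  have inv: "tw (tw x) = x" if "x \<in> G" for x
    using assms that by (simp add: involutive_def)
  show "involutive V" by (simp add: involutive_def inv)
  have "s (l * l) e = s 1 e" using inv[of e] by simp
  then have "B (s (l * l) e) b = B (s 1 e) b" by simp
  then have "l * l = 1" by simp
  then show l: "l \<in> {-1, 1}" by (auto simp: square_eq_1_iff)
  have "tw (s l b + x0 + s l0 e) = b"
    by (simp only: tw_b[symmetric] inv b_G)
  then have twtwb: "s l (tw b) + tw x0 + s l0 (s l e) = b"
    by simp
  have "P (s l (tw b) + tw x0 + s l0 (s l e)) = 0"
    by (simp only: twtwb P_b)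
  then have "s l x0 + P (tw x0) = 0" by (simp add: x0_def[symmetric])
  then show "twist V x0 = - s l x0" by (simp add: add_eq_0_iff)
  have "B (s l (tw b) + tw x0 + s l0 (s l e)) b = 0"
    by (simp only: twtwb Bbb)
  moreover have "B (tw x0) b = B x0 x0"
    by (simp add: twist_adjoint tw_b)
  \<comment> \<open>The summands \<open>s l (tw b)\<close> and \<open>s l0 (s l e)\<close> each
    contribute \<open>l * l0\<close>; the factor 2 is invertible in characteristic 0.\<close>
  ultimately have "2 * (l * l0) = - B x0 x0"
    by (simp add: l0_def[symmetric] algebra_simps eq_neg_iff_add_eq_0)
  then show "l0 = - (1 / (2 * l)) * B x0 x0"
    using l by (auto simp: field_simps)
qed

lemma regular_V:
  assumes "regular A"
  shows "regular V" "l \<noteq> 0"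
proof -
  have inj: "x = y" if "x \<in> G" "y \<in> G" "tw x = tw y" for x y
    using assms that inj_onD[of tw G x y] by (simp add: regular_def bij_betw_def)
  show l: "l \<noteq> 0"
  proof
    assume "l = 0"
    then have "e = 0" using inj[of e 0] by simp
    then show False using Bbe by simp
  qed
  have "inj_on (twist V) H"
  proof (rule inj_onI)
    fix x y assume xy: "x \<in> H" "y \<in> H" "twist V x = twist V y"
    \<comment> \<open>The twist of \<open>x - y\<close> is a multiple of \<open>e\<close>, hence the
      twist of a multiple of \<open>e\<close> as \<open>l\<close> is nonzero; injectivity puts
      \<open>x - y\<close> on the line that \<open>P\<close> kills.\<close>
    define c where "c = B (tw (x - y)) b"
    have "tw (x - y) = s (B (tw (x - y)) e) b + P (tw (x - y)) + s c e"
      unfolding c_def by (rule decompose)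
    also have "\<dots> = s c e" using xy by simp
    also have "\<dots> = tw (s (c / l) e)" using l by simp
    finally have tw_eq: "tw (x - y) = tw (s (c / l) e)" .
    have "x - y \<in> G" using xy(1,2) by simp
    moreover have "s (c / l) e \<in> G" by simp
    ultimately have eq: "x - y = s (c / l) e" by (rule inj[OF _ _ tw_eq])
    have "x - y = P (x - y)" using xy(1,2) by simp
    also have "\<dots> = 0" by (simp only: eq) simp
    finally show "x = y" by simp
  qed
  moreover have "twist V ` H = H"
  proof
    show "twist V ` H \<subseteq> H" by (rule image_subsetI) simp
    show "H \<subseteq> twist V ` H"
    proof
      fix y assume y: "y \<in> H"
      then have "y \<in> tw ` G"
        using assms by (simp add: regular_def bij_betw_def)
      then obtain x where x: "x \<in> G" "tw x = y" by blast
      \<comment> \<open>A preimage of \<open>y\<close> in \<open>G\<close> is thus orthogonal to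
        \<open>e\<close>, so projecting it to \<open>H\<close> changes its twist only by a multiple
        of \<open>e\<close>.\<close>
      then have "l * B x e = 0" using y B_tw_e[of x] by simp
      then have "twist V (P x) = y" using x y l by simp
      then show "y \<in> twist V ` H" using x P_H by blast
    qed
  qed
  ultimately show "regular V" by (simp add: regular_def bij_betw_def)
qed

end

section \<open>Existence of the hyperbolic pair\<close>

lemma (in quadratic_hl) ex_center_eigenvector:
  assumes "multiplicative A" "finite_dim s G" "hl_center A \<noteq> {0}"
    and roots: "\<And>p :: 'k poly. degree p > 0 \<Longrightarrow> \<exists>z. poly p z = 0"
  shows "\<exists>e\<in>hl_center A. \<exists>l. e \<noteq> 0 \<and> tw e = s l e"
proof -
  obtain F where F: "finite F" "span F = G"
    using assms by (auto simp: finite_dim_def)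
  have lin: "linear_on s s (hl_center A) tw" and sub: "hl_center A \<subseteq> span F"
    using F by (auto simp: linear_on_def hl_center_def)
  obtain x where x: "x \<in> hl_center A" "x \<noteq> 0"
    using assms(3) subspace_0[OF subspace_center] by blast
  \<comment> \<open>The three context assumptions of the eigenvector lemmas, for the center as
    \<open>W\<close>.\<close>
  note tw = subspace_center center_twist_closed[OF assms(1)] lin
  obtain p where "p \<noteq> 0" "poly_action s tw p x = 0"
    using ex_annihilating_poly[OF tw x(1) F(1) sub] by blast
  with ex_eigenvector_if_annihilated[OF tw roots x] show ?thesis by blast
qed

lemma (in quadratic_hl) eigenvector_isotropic:
  assumes "hl_irreducible s A" "dim G > 1" "e \<in> hl_center A" "e \<noteq> 0" "tw e = s l e"
  shows "B e e = 0"
proof (rule ccontr)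
  assume "B e e \<noteq> 0"
  have e: "e \<in> G" "\<And>x. x \<in> G \<Longrightarrow> br e x = 0"
    using assms(3) by (auto simp: hl_center_def)
  have "hl_ideal s A (span {e})"
    unfolding hl_ideal_def using subspace_span[of "{e}"] e assms(5)
    by (auto simp: span_singleton)
  moreover have "nondegenerate_on (span {e}) B"
    unfolding nondegenerate_on_def using e \<open>B e e \<noteq> 0\<close>
    by (auto simp: span_singleton)
  ultimately have "span {e} = {0} \<or> span {e} = G"
    using assms(1) by (simp add: hl_irreducible_def)
  moreover have "e \<in> span {e}" by (simp add: span_base)
  \<comment> \<open>Irreducibility leaves only this case, which the dimension excludes.\<close>
  ultimately have "G = span {e}" using assms(4) by blast
  moreover have "dim (span {e}) \<le> 1"
    using dim_le_card[of "span {e}" "{e}"] by simp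
  ultimately show False using assms(2) by simp
qed

lemma (in quadratic_hl) ex_isotropic_partner:
  assumes "(2::'k) \<noteq> 0" "e \<in> G" "e \<noteq> 0" "B e e = 0"
  shows "\<exists>b\<in>G. B b e = 1 \<and> B b b = 0"
proof -
  obtain y where y: "y \<in> G" "B e y \<noteq> 0"
    using eq_0_if_orthogonal assms by blast
  define c where "c = s (1 / B e y) y"
  have c: "c \<in> G" "B e c = 1" "B c e = 1"
    using y assms form_sym[of y e] by (simp_all add: c_def)
  \<comment> \<open>Subtracting \<open>s t e\<close> from \<open>c\<close> lowers
    \<open>B c c\<close> by \<open>2 * t\<close> and keeps the pairing with the isotropic
    \<open>e\<close>; \<open>t = B c c / 2\<close> makes the result isotropic.\<close>
  have "B (c - s (B c c / 2) e) (c - s (B c c / 2) e) = 0"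
    using c assms by (simp add: field_simps)
  moreover have "B (c - s (B c c / 2) e) e = 1"
    using c assms by simp
  ultimately show ?thesis using c assms by (intro bexI[of _ "c - s (B c c / 2) e"]) simp_all
qed

theorem theorem7p3:
  fixes s :: "'k::{alg_closed_field, field_char_0} \<Rightarrow> 'v::ab_group_add \<Rightarrow> 'v"
    and A :: "('k, 'v) qhl"
  assumes "quadratic_hom_lie s A"
    and "multiplicative A"
    and "finite_dim s (carr A)"
    and "hl_irreducible s A"
    and "vector_space.dim s (carr A) > 1"
    and "hl_center A \<noteq> {0}"
  shows "(\<exists>V. vector_space.dim s (carr V) = vector_space.dim s (carr A) - 2 \<and>
              is_double_extension s A V)
       \<and> (involutive A \<longrightarrow> (\<exists>V. involutive V \<and> is_involutive_double_extension s A V))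
       \<and> (regular A \<longrightarrow> (\<exists>V. regular V \<and> is_regular_double_extension s A V))"
proof -
  have "vector_space s"
    using assms(1) by (simp add: quadratic_hom_lie_def hom_lie_def)
  then interpret quadratic_hl s A
    using assms(1) by (simp add: quadratic_hl_def quadratic_hl_axioms_def)
  obtain e l where e: "e \<in> hl_center A" "e \<noteq> 0" "twist A e = s l e"
    using ex_center_eigenvector assms alg_closed_imp_poly_has_root by blast
  have ee: "form A e e = 0"
    using eigenvector_isotropic assms e by blast
  obtain b where b: "b \<in> carr A" "form A b e = 1" "form A b b = 0"
    using ex_isotropic_partner[of e] e ee by (auto simp: hl_center_def)
  interpret central_reduction s A e b l
    by unfold_locales (use assms e ee b in auto)
  \<comment> \<open>One and the same \<open>V\<close> witnesses all three claims.\<close>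
  have "dim (carr V) = dim (carr A) - 2"
    using dim_G assms(3) by simp
  moreover have "is_double_extension s A V"
    unfolding is_double_extension_def using is_dext_by_V by blast
  moreover have "is_involutive_double_extension s A V" if "involutive A"
    unfolding is_involutive_double_extension_def
    using is_dext_by_V involutive_V[OF that] V_simps(4) by metis
  moreover have "is_regular_double_extension s A V" if "regular A"
    unfolding is_regular_double_extension_def
    using is_dext_by_V regular_V[OF that] by blast
  ultimately show ?thesis
    using involutive_V(1) regular_V(1) by blast
qed

end
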